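(* Let $k\ge2$, let $\gamma,\delta\in\mathcal P_k$ and let $m,n$ be positive integers. The paths $\gamma$ and $\delta$ are $m$-periodic and $n$-periodic, respectively, if and only if the tiling $\mathcal M=\Phi(\gamma,\delta)$ is $(m\times n)$-periodic.
   Context: A path is a bi-infinite sequence $\gamma=(\gamma_i)_{i\in\mathbb Z}$ of column vectors $\gamma_i\in\mathbb Z^k$ such that every matrix $(\gamma_i,\ldots,\gamma_{i+k-1})$ lies in $SL_k(\mathbb Z)$; $\mathcal P_k$ is the set of paths. $\Phi(\gamma,\delta)$ is the array $(m_{i\,j})_{i,j\in\mathbb Z}$ with $m_{i\,j}=\det(\gamma_i,\ldots,\gamma_{i+k-2},\delta_j)$. A path $\gamma$ is $p$-periodic if $\gamma_i=\gamma_{i+p}$ for all $i\in\mathbb Z$. A tiling $(m_{i\,j})$ is $(p\times q)$-periodic if $m_{i\,j}=m_{i+p,\,j}=m_{i,\,j+q}=m_{i+p,\,j+q}$ for all $i,j\in\mathbb Z$. *)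

theory Defs
  imports "Jordan_Normal_Form.Determinant"
begin

definition SL :: "nat \<Rightarrow> int mat set" where
  "SL k = {A \<in> carrier_mat k k. det A = 1}"

(* The carrier condition is not implied by the determinant condition: mat_of_cols reads
   only the first k entries of each column, whatever its dimension. *)
definition paths :: "nat \<Rightarrow> (int \<Rightarrow> int vec) set" where
  "paths k = {\<gamma>. (\<forall>i. \<gamma> i \<in> carrier_vec k) \<and>
     (\<forall>i. mat_of_cols k (map (\<lambda>l. \<gamma> (i + int l)) [0..<k]) \<in> SL k)}"

definition Phi :: "nat \<Rightarrow> (int \<Rightarrow> int vec) \<Rightarrow> (int \<Rightarrow> int vec) \<Rightarrow> int \<Rightarrow> int \<Rightarrow> int" where
  "Phi k \<gamma> \<delta> i j =
     det (mat_of_cols k (map (\<lambda>l. \<gamma> (i + int l)) [0..<k - 1] @ [\<delta> j]))"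

definition path_periodic :: "nat \<Rightarrow> (int \<Rightarrow> int vec) \<Rightarrow> bool" where
  "path_periodic p \<gamma> \<longleftrightarrow> (\<forall>i. \<gamma> i = \<gamma> (i + int p))"

definition tiling_periodic :: "nat \<Rightarrow> nat \<Rightarrow> (int \<Rightarrow> int \<Rightarrow> int) \<Rightarrow> bool" where
  "tiling_periodic p q M \<longleftrightarrow> (\<forall>i j.
     M i j = M (i + int p) j \<and>
     M (i + int p) j = M i (j + int q) \<and>
     M i (j + int q) = M (i + int p) (j + int q))"

end

theory Submission imports Defs begin

text \<open>
  The entries are \<open>m\<^sub>i\<^sub>j = w\<^sub>i \<bullet> \<delta>\<^sub>j\<close>, where \<open>w\<^sub>i\<close> is the generalised cross product of
  \<open>\<gamma>\<^sub>i, \<dots>, \<gamma>\<^sub>i\<^sub>+\<^sub>k\<^sub>-\<^sub>2\<close>. Since \<open>w\<^sub>i\<close> is orthogonal to these vectors and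
  \<open>w\<^sub>i \<bullet> \<gamma>\<^sub>i\<^sub>+\<^sub>k\<^sub>-\<^sub>1 = 1\<close>, the products of \<open>k\<close> consecutive \<open>w\<close> with the next \<open>k\<close> consecutive
  \<open>\<gamma>\<close> form a unitriangular matrix, so \<open>k\<close> consecutive \<open>w\<close> separate vectors. Periodicity of the
  tiling in \<open>j\<close> therefore makes \<open>\<delta>\<close> periodic. Periodicity in \<open>i\<close> makes \<open>w\<close> periodic, as \<open>k\<close>
  consecutive \<open>\<delta>\<close> also separate vectors, and then \<open>\<gamma>\<close> is periodic, because \<open>\<gamma>\<^sub>i\<^sub>+\<^sub>k\<^sub>-\<^sub>1\<close> is
  determined by its products with \<open>w\<^sub>i, \<dots>, w\<^sub>i\<^sub>+\<^sub>k\<^sub>-\<^sub>1\<close>.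
\<close>

text \<open>Over an integral domain a square matrix with nonzero determinant has trivial kernel, and
  the matrix with rows \<open>w a\<close> kills \<open>u - v\<close>.\<close>

lemma vec_eqI_scalar_prods:
  fixes u v :: "'a :: idom vec"
  assumes w: "\<And>a. a < k \<Longrightarrow> w a \<in> carrier_vec k"
    and det: "det (mat_of_cols k (map w [0..<k])) \<noteq> 0"
    and u: "u \<in> carrier_vec k" and v: "v \<in> carrier_vec k"
    and eq: "\<And>a. a < k \<Longrightarrow> w a \<bullet> u = w a \<bullet> v"
  shows "u = v"
proof -
  let ?W = "mat_of_rows k (map w [0..<k])"
  have W: "?W \<in> carrier_mat k k"
    using mat_of_rows_carrier(1)[of k "map w [0..<k]"] by simp
  have "det ?W \<noteq> 0"
    using det det_transpose[OF W] by (simp add: transpose_mat_of_rows)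
  moreover have "?W *\<^sub>v (u - v) = 0\<^sub>v k"
    by (rule eq_vecI) (use w u v eq in \<open>auto simp: scalar_prod_minus_distrib[of _ k]\<close>)
  moreover have "u - v \<in> carrier_vec k"
    using u v by simp
  ultimately have "u - v = 0\<^sub>v k"
    using det_0_iff_vec_prod_zero[OF W] by blast
  then show ?thesis
    using u v by (metis carrier_vecD eq_iff_diff_eq_0 eq_vecI index_minus_vec(1) index_zero_vec(1))
qed

text \<open>The zero vector is a placeholder: cofactors along the last column do not see that
  column.\<close>

definition cross_vec :: "nat \<Rightarrow> 'a :: comm_ring_1 vec list \<Rightarrow> 'a vec" where
  "cross_vec k cs = vec k (\<lambda>r. cofactor (mat_of_cols k (cs @ [0\<^sub>v k])) r (k - 1))"

lemma cross_vec_carrier [simp]: "cross_vec k cs \<in> carrier_vec k"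
  by (simp add: cross_vec_def)

lemma cross_vec_scalar_prod:
  fixes v :: "'a :: comm_ring_1 vec"
  assumes k: "length cs = k - 1" "k > 0" and v: "v \<in> carrier_vec k"
  shows "cross_vec k cs \<bullet> v = det (mat_of_cols k (cs @ [v]))"
proof -
  let ?A = "mat_of_cols k (cs @ [v])"
  let ?B = "mat_of_cols k (cs @ [0\<^sub>v k])"
  have A: "?A \<in> carrier_mat k k"
    using mat_of_cols_carrier(1)[of k "cs @ [v]"] k by simp
  have "mat_delete ?A r (k - 1) = mat_delete ?B r (k - 1)" for r
    by (rule eq_matI) (use k in \<open>auto simp: mat_delete_def mat_of_cols_index nth_append\<close>)
  then have "cofactor ?A r (k - 1) = cofactor ?B r (k - 1)" for r
    by (simp add: cofactor_def)
  moreover have "?A $$ (r, k - 1) = v $ r" if "r < k" for r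
    using that k by (simp add: mat_of_cols_index nth_append)
  ultimately have "det ?A = (\<Sum>r<k. v $ r * cofactor ?B r (k - 1))"
    using laplace_expansion_column[OF A, of "k - 1"] k by simp
  then show ?thesis
    using v by (simp add: cross_vec_def scalar_prod_def lessThan_atLeast0 mult.commute)
qed

context
  fixes k :: nat and \<gamma> :: "int \<Rightarrow> int vec"
  assumes k: "k > 0" and path: "\<gamma> \<in> paths k"
begin

definition path_cross :: "int \<Rightarrow> int vec" where
  "path_cross i = cross_vec k (map (\<lambda>l. \<gamma> (i + int l)) [0..<k - 1])"

lemma path_carrier: "\<gamma> i \<in> carrier_vec k"
  using path by (simp add: paths_def)

lemma path_det: "det (mat_of_cols k (map (\<lambda>l. \<gamma> (i + int l)) [0..<k])) = 1"
  using path by (simp add: paths_def SL_def)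

lemma path_cross_carrier: "path_cross i \<in> carrier_vec k"
  by (simp add: path_cross_def)

lemma Phi_eq_scalar_prod:
  assumes "\<delta> j \<in> carrier_vec k"
  shows "Phi k \<gamma> \<delta> i j = path_cross i \<bullet> \<delta> j"
  using assms k by (simp add: Phi_def path_cross_def cross_vec_scalar_prod)

text \<open>For \<open>l < k - 1\<close> the determinant has a repeated column; for
  \<open>l = k - 1\<close> it is that of a full window of the path.\<close>

lemma path_cross_self:
  assumes l: "l < k"
  shows "path_cross i \<bullet> \<gamma> (i + int l) = (if l = k - 1 then 1 else 0)"
proof -
  let ?cs = "map (\<lambda>l. \<gamma> (i + int l)) [0..<k - 1]"
  let ?A = "mat_of_cols k (?cs @ [\<gamma> (i + int l)])"
  have prod: "path_cross i \<bullet> \<gamma> (i + int l) = det ?A"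
    using k by (simp add: path_cross_def cross_vec_scalar_prod path_carrier)
  show ?thesis
  proof (cases "l = k - 1")
    case True
    have "[0..<k] = [0..<k - 1] @ [k - 1]"
      using k by (metis Suc_diff_1 upt_Suc_append zero_le)
    then show ?thesis
      using True path_det[of i] prod by simp
  next
    case False
    have "?A \<in> carrier_mat k k"
      using mat_of_cols_carrier(1)[of k "?cs @ [\<gamma> (i + int l)]"] k by simp
    moreover have "col ?A l = col ?A (k - 1)"
      by (rule eq_vecI) (use False l k in \<open>auto simp: mat_of_cols_index nth_append\<close>)
    ultimately have "det ?A = 0"
      using False l k by (intro det_identical_columns[of _ k l "k - 1"]) auto
    then show ?thesis
      using False prod by simp
  qed
qed

lemma det_path_cross: "det (mat_of_cols k (map (\<lambda>a. path_cross (i + int a)) [0..<k])) = 1"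
proof -
  let ?ws = "map (\<lambda>a. path_cross (i + int a)) [0..<k]"
  \<comment> \<open>The window starts at offset \<open>k - 1\<close>, so that diagonal entries pair
    \<open>path_cross (i + int a)\<close> with the vector completing its window, and entries below
    the diagonal pair it with vectors it is orthogonal to.\<close>
  let ?gs = "map (\<lambda>b. \<gamma> (i + int (k - 1) + int b)) [0..<k]"
  let ?W = "mat_of_rows k ?ws" and ?G = "mat_of_cols k ?gs"
  have W: "?W \<in> carrier_mat k k" and G: "?G \<in> carrier_mat k k"
    using mat_of_rows_carrier(1)[of k ?ws] mat_of_cols_carrier(1)[of k ?gs] by simp_all
  have entry: "(?W * ?G) $$ (a, b) = (if b = a then 1 else 0)" if "b \<le> a" "a < k" for a b
  proof -
    have "(?W * ?G) $$ (a, b) = path_cross (i + int a) \<bullet> \<gamma> (i + int (k - 1) + int b)"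
      using that by (simp add: path_carrier path_cross_carrier)
    also have "i + int (k - 1) + int b = (i + int a) + int (k - 1 + b - a)"
      using that by simp
    also have "path_cross (i + int a) \<bullet> \<gamma> \<dots> = (if b = a then 1 else 0)"
      using that by (subst path_cross_self) auto
    finally show ?thesis .
  qed
  have "upper_triangular (?W * ?G)"
    using entry by (auto simp: upper_triangular_def)
  then have "det (?W * ?G) = prod_list (diag_mat (?W * ?G))"
    using W G by (intro det_upper_triangular[of _ k]) auto
  also have "\<dots> = 1"
    using entry by (simp add: prod_list_diag_prod)
  finally have "det ?W = 1"
    using det_mult[OF W G] path_det[of "i + int (k - 1)"] by simp
  then show ?thesis
    using det_transpose[OF W] by (simp add: transpose_mat_of_rows)
qed

lemma eq_if_path_cross_prods_eq:
  assumes "u \<in> carrier_vec k" "v \<in> carrier_vec k"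
    and "\<And>a. a < k \<Longrightarrow> path_cross (i + int a) \<bullet> u = path_cross (i + int a) \<bullet> v"
  shows "u = v"
  using vec_eqI_scalar_prods[of k "\<lambda>a. path_cross (i + int a)" u v] assms
  by (simp add: det_path_cross path_cross_carrier)

lemma eq_if_path_prods_eq:
  assumes "u \<in> carrier_vec k" "v \<in> carrier_vec k"
    and "\<And>j. u \<bullet> \<gamma> j = v \<bullet> \<gamma> j"
  shows "u = v"
proof (rule vec_eqI_scalar_prods[of k "\<lambda>l. \<gamma> (0 + int l)"])
  show "\<gamma> (0 + int a) \<bullet> u = \<gamma> (0 + int a) \<bullet> v" for a
    using assms path_carrier comm_scalar_prod by metis
qed (use assms path_det[of 0] in \<open>simp_all add: path_carrier\<close>)

lemma path_periodic_if_path_cross_periodic: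
  assumes per: "\<And>i. path_cross i = path_cross (i + int p)"
  shows "path_periodic p \<gamma>"
  unfolding path_periodic_def
proof
  fix i
  \<comment> \<open>With this \<open>s\<close>, each of the \<open>k\<close> windows starting at
    \<open>s + int a\<close> contains the index \<open>i\<close>.\<close>
  define s where "s = i - int (k - 1)"
  show "\<gamma> i = \<gamma> (i + int p)"
  proof (rule eq_if_path_cross_prods_eq[of _ _ s])
    fix a assume a: "a < k"
    have i: "i = (s + int a) + int (k - 1 - a)"
      and ip: "i + int p = (s + int a + int p) + int (k - 1 - a)"
      using a by (simp_all add: s_def)
    \<comment> \<open>Both products are the same 0 or 1, since the offset \<open>k - 1 - a\<close>
      within the window is the same.\<close>
    have "path_cross (s + int a) \<bullet> \<gamma> i = path_cross (s + int a + int p) \<bullet> \<gamma> (i + int p)"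
      unfolding i[symmetric] ip
      using a path_cross_self[of "k - 1 - a" "s + int a"]
        path_cross_self[of "k - 1 - a" "s + int a + int p"] i by simp
    then show "path_cross (s + int a) \<bullet> \<gamma> i = path_cross (s + int a) \<bullet> \<gamma> (i + int p)"
      using per by simp
  qed (simp_all add: path_carrier)
qed

end

lemma tiling_periodic_iff:
  "tiling_periodic p q M \<longleftrightarrow>
     (\<forall>i j. M i j = M (i + int p) j) \<and> (\<forall>i j. M i j = M i (j + int q))"
  unfolding tiling_periodic_def by metis

theorem corollary4p6:
  fixes k m n :: nat and \<gamma> \<delta> :: "int \<Rightarrow> int vec"
  assumes "k \<ge> 2"
    and "\<gamma> \<in> paths k" and "\<delta> \<in> paths k"
    and "m > 0" and "n > 0"
  shows "(path_periodic m \<gamma> \<and> path_periodic n \<delta>) \<longleftrightarrow> tiling_periodic m n (Phi k \<gamma> \<delta>)"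
proof
  assume per: "path_periodic m \<gamma> \<and> path_periodic n \<delta>"
  have \<gamma>: "\<gamma> (i + int m + int l) = \<gamma> (i + int l)" for i l
    using per by (metis path_periodic_def add.assoc add.commute)
  have \<delta>: "\<delta> (j + int n) = \<delta> j" for j
    using per by (simp add: path_periodic_def)
  show "tiling_periodic m n (Phi k \<gamma> \<delta>)"
    by (simp add: tiling_periodic_iff Phi_def \<gamma> \<delta>)
next
  assume tiling: "tiling_periodic m n (Phi k \<gamma> \<delta>)"
  have k: "k > 0"
    using assms(1) by simp
  note \<gamma> = k assms(2) and \<delta> = k assms(3)
  let ?w = "path_cross k \<gamma>"
  have Phi: "Phi k \<gamma> \<delta> i j = ?w i \<bullet> \<delta> j" for i j
    by (simp add: Phi_eq_scalar_prod[OF \<gamma>] path_carrier[OF \<delta>])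
  have "?w i = ?w (i + int m)" for i
  \<comment> \<open>Here the vectors of \<delta> separate the cross products; below, the cross
    products separate the vectors of \<delta>.\<close>
  proof (rule eq_if_path_prods_eq[OF \<delta>])
    show "?w i \<bullet> \<delta> j = ?w (i + int m) \<bullet> \<delta> j" for j
      using tiling Phi by (metis tiling_periodic_iff)
  qed (simp_all add: path_cross_carrier[OF \<gamma>])
  then have "path_periodic m \<gamma>"
    by (rule path_periodic_if_path_cross_periodic[OF \<gamma>])
  moreover have "\<delta> j = \<delta> (j + int n)" for j
  proof (rule eq_if_path_cross_prods_eq[OF \<gamma>])
    show "?w (0 + int a) \<bullet> \<delta> j = ?w (0 + int a) \<bullet> \<delta> (j + int n)" for a
      using tiling Phi by (metis tiling_periodic_iff)
  qed (simp_all add: path_carrier[OF \<delta>])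
  ultimately show "path_periodic m \<gamma> \<and> path_periodic n \<delta>"
    by (simp add: path_periodic_def)
qed

end
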